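(* Let $K$ be a finite field. Each cyclic semifield $\mathbb{S}_T$ (defined by an irreducible invertible semilinear transformation $T \in \Gamma L(d,K)$) is isotopic to a semifield $\mathbb{S}_f$ for some irreducible element $f$ of some skew polynomial ring $K[t;\sigma]$, $\sigma\in \mathrm{Aut}(K)$. Conversely, for every $\sigma\in\mathrm{Aut}(K)$ and every irreducible $f\in K[t;\sigma]$, the semifield $\mathbb{S}_f$ is isotopic to a cyclic semifield $\mathbb{S}_T$ for some irreducible invertible semilinear transformation $T$ of a $K$-vector space of dimension $\deg(f)$.
   Context: For a field $K$ and $\sigma\in\mathrm{Aut}(K)$, the skew polynomial ring $K[t;\sigma]$ is the set of polynomials in $t$ with coefficients in $K$ (written on the left), with termwise addition and multiplication determined by $ta=a^{\sigma}t$ for $a\in K$. An element $f$ of positive degree is irreducible if there are no $a,b$ with $\deg(a),\deg(b)<\deg(f)$ and $f=ab$. The ring is right-Euclidean: for $f\neq 0$ every $a$ can be written uniquely as $a=uf+v$ with $\deg(v)<\deg(f)$, and we write $v = a \bmod f$. For $f$ irreducible of degree $d$, $\mathbb{S}_f=(V,\circ_f)$ is the semifield on the set $V$ of elements of $K[t;\sigma]$ of degree less than $d$, with the usual addition and multiplication $a\circ_f b := ab \bmod f$. A semilinear transformation on $V=K^d$ is an additive map $T:V\to V$ such that $T(\alpha v)=\alpha^{\sigma}T(v)$ for all $\alpha\in K$, $v\in V$, for some $\sigma\in\mathrm{Aut}(K)$; the invertible ones form the group $\Gamma L(d,K)$. $T$ is irreducible if its only invariant $K$-subspaces are $\{0\}$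 and $V$. Given an irreducible $T\in\Gamma L(d,K)$ and a fixed $K$-basis $\{e_0,\dots,e_{d-1}\}$ of $V$, the cyclic semifield $\mathbb{S}_T=(V,\circ)$ has multiplication $a\circ b=\sum_{i=0}^{d-1}a_iT^i(b)$, where $a=\sum_{i=0}^{d-1}a_ie_i$. (This multiplication is biadditive and has no zero divisors; an identity element is not required for the notion of isotopism.) Two such algebras $(\mathbb{S},\circ)$ and $(\hat{\mathbb{S}},\hat\circ)$ are isotopic if there is a triple $(F,G,H)$ of bijective additive (i.e. linear over the prime field) maps from $\mathbb{S}$ to $\hat{\mathbb{S}}$ with $x^F\,\hat\circ\, y^G=(x\circ y)^H$ for all $x,y\in\mathbb{S}$. *)

theory Defs
  imports "HOL-Computational_Algebra.Polynomial" "Jordan_Normal_Form.VS_Connect"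
begin

section \<open>Skew polynomials\<close>

text \<open>
  Elements of \<open>K[t;\<sigma>]\<close> are represented by the type \<^typ>\<open>'k poly\<close> (coefficients on the left of the
  powers of \<open>t\<close>), of which only the additive structure, the coefficients and the degree are used.
  Since \<open>t a = \<sigma>(a) t\<close>, we have \<open>(a t^i) (b t^j) = a \<sigma>^i(b) t^(i+j)\<close>.
\<close>

definition skew_mult :: "('k::field \<Rightarrow> 'k) \<Rightarrow> 'k poly \<Rightarrow> 'k poly \<Rightarrow> 'k poly" where
  "skew_mult \<sigma> a b =
     (\<Sum>i\<le>degree a. \<Sum>j\<le>degree b. monom (coeff a i * (\<sigma> ^^ i) (coeff b j)) (i + j))"

lemma skew_mult_commutation:
  fixes a :: "'k::field"
  assumes "field_isom \<sigma>"
  shows "skew_mult \<sigma> (monom 1 1) [:a:] = skew_mult \<sigma> [:\<sigma> a:] (monom 1 1)"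
proof -
  interpret field_isom \<sigma> by fact
  show ?thesis by (simp add: skew_mult_def degree_monom_eq)
qed

definition skew_irreducible :: "('k::field \<Rightarrow> 'k) \<Rightarrow> 'k poly \<Rightarrow> bool" where
  "skew_irreducible \<sigma> f \<longleftrightarrow> degree f > 0 \<and>
     \<not> (\<exists>a b. degree a < degree f \<and> degree b < degree f \<and> f = skew_mult \<sigma> a b)"

text \<open>
  The condition \<open>v = 0\<close> below accounts for the convention that the zero polynomial has degree
  smaller than every other polynomial, whereas \<^prop>\<open>degree (0 :: 'k::zero poly) = 0\<close> here.
\<close>

definition skew_mod :: "('k::field \<Rightarrow> 'k) \<Rightarrow> 'k poly \<Rightarrow> 'k poly \<Rightarrow> 'k poly" where
  "skew_mod \<sigma> a f =
     (THE v. (v = 0 \<or> degree v < degree f) \<and> (\<exists>u. a = skew_mult \<sigma> u f + v))"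

definition Sf_carrier :: "'k::field poly \<Rightarrow> 'k poly set" where
  "Sf_carrier f = {a. a = 0 \<or> degree a < degree f}"

definition Sf_mult :: "('k::field \<Rightarrow> 'k) \<Rightarrow> 'k poly \<Rightarrow> 'k poly \<Rightarrow> 'k poly \<Rightarrow> 'k poly" where
  "Sf_mult \<sigma> f a b = skew_mod \<sigma> (skew_mult \<sigma> a b) f"


section \<open>Semilinear transformations and cyclic semifields\<close>

text \<open>
  Transformations of \<open>K^d\<close> are total functions on \<^typ>\<open>'k vec\<close>; only their values on
  \<^term>\<open>carrier_vec d\<close> matter.
\<close>

definition semilinear :: "nat \<Rightarrow> ('k::field \<Rightarrow> 'k) \<Rightarrow> ('k vec \<Rightarrow> 'k vec) \<Rightarrow> bool" where
  "semilinear d \<sigma> T \<longleftrightarrow>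
     T \<in> carrier_vec d \<rightarrow> carrier_vec d \<and>
     (\<forall>v \<in> carrier_vec d. \<forall>w \<in> carrier_vec d. T (v + w) = T v + T w) \<and>
     (\<forall>\<alpha>. \<forall>v \<in> carrier_vec d. T (\<alpha> \<cdot>\<^sub>v v) = \<sigma> \<alpha> \<cdot>\<^sub>v T v)"

definition GammaL :: "nat \<Rightarrow> ('k::field vec \<Rightarrow> 'k vec) set" where
  "GammaL d = {T. (\<exists>\<sigma>. field_isom \<sigma> \<and> semilinear d \<sigma> T) \<and>
                  bij_betw T (carrier_vec d) (carrier_vec d)}"

definition irreducible_transformation :: "nat \<Rightarrow> ('k::field vec \<Rightarrow> 'k vec) \<Rightarrow> bool" where
  "irreducible_transformation d T \<longleftrightarrow>
     (\<forall>W. VectorSpace.subspace class_ring W (module_vec TYPE('k) d) \<and> T ` W \<subseteq> W \<longrightarrow>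
          W = {0\<^sub>v d} \<or> W = carrier_vec d)"

definition indexed_basis :: "nat \<Rightarrow> (nat \<Rightarrow> 'k::field vec) \<Rightarrow> bool" where
  "indexed_basis d e \<longleftrightarrow> inj_on e {..<d} \<and>
     vectorspace.basis class_ring (module_vec TYPE('k) d) (e ` {..<d})"

definition coordinates :: "nat \<Rightarrow> (nat \<Rightarrow> 'k::field vec) \<Rightarrow> 'k vec \<Rightarrow> 'k vec" where
  "coordinates d e a = (THE c. c \<in> carrier_vec d \<and>
     a = finsum_vec TYPE('k) d (\<lambda>i. c $ i \<cdot>\<^sub>v e i) {..<d})"

definition ST_mult ::
  "nat \<Rightarrow> (nat \<Rightarrow> 'k::field vec) \<Rightarrow> ('k vec \<Rightarrow> 'k vec) \<Rightarrow> 'k vec \<Rightarrow> 'k vec \<Rightarrow> 'k vec" where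
  "ST_mult d e T a b =
     finsum_vec TYPE('k) d (\<lambda>i. coordinates d e a $ i \<cdot>\<^sub>v (T ^^ i) b) {..<d}"


section \<open>Isotopism\<close>

definition additive_bij :: "('a::plus \<Rightarrow> 'b::plus) \<Rightarrow> 'a set \<Rightarrow> 'b set \<Rightarrow> bool" where
  "additive_bij F A B \<longleftrightarrow> bij_betw F A B \<and> (\<forall>x\<in>A. \<forall>y\<in>A. F (x + y) = F x + F y)"

text \<open>An algebra is given by its carrier and its multiplication; its addition is that of the type.\<close>

definition isotopic ::
  "'a::plus set \<Rightarrow> ('a \<Rightarrow> 'a \<Rightarrow> 'a) \<Rightarrow> 'b::plus set \<Rightarrow> ('b \<Rightarrow> 'b \<Rightarrow> 'b) \<Rightarrow> bool" where
  "isotopic A m B n \<longleftrightarrow> (\<exists>F G H. additive_bij F A B \<and> additive_bij G A B \<and> additive_bij H A B \<and>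
     (\<forall>x\<in>A. \<forall>y\<in>A. n (F x) (G y) = H (m x y)))"

end

theory Submission
  imports Defs
begin

text \<open>
  Let \<open>R = K[t;\<sigma>]\<close>. A \<open>K\<close>-space with a \<open>\<sigma>\<close>-semilinear map \<open>T\<close> is the same thing as a left \<open>R\<close>-module,
  on which \<open>a = \<Sum> a\<^sub>i t\<^sup>i\<close> acts as \<open>a(T) = \<Sum> a\<^sub>i T\<^sup>i\<close>, and \<open>T\<close> is irreducible iff this module is
  simple. Both kinds of semifield are instances of one construction on such a module \<open>V\<close>, the
  product \<open>(a, v) \<mapsto> a(T) v\<close> with \<open>a\<close> ranging over the polynomials of degree below \<open>d = dim V\<close>.
  For a cyclic semifield this is the definition of the product, once the first factor is replaced by
  the polynomial of its coordinates (\<open>ST_isotopic_poly_act\<close>). For \<open>\<S>\<^sub>f\<close> the module is \<open>R/Rf\<close> and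
  \<open>T\<^sub>f\<close> is left multiplication by \<open>t\<close> modulo \<open>f\<close>: reducing \<open>ab\<close> modulo \<open>f\<close> is the same as applying
  \<open>a(T\<^sub>f)\<close> to \<open>b\<close> (\<open>skew_mod_mult_eq_poly_act\<close>). It remains to see that simple modules of dimension
  \<open>d\<close> and modules \<open>R/Rf\<close> with \<open>f\<close> irreducible of degree \<open>d\<close> correspond.

  Let \<open>T\<close> be irreducible. For every nonzero vector \<open>w\<close> the map \<open>a \<mapsto> a(T) w\<close> is a bijection from the
  polynomials of degree below \<open>d\<close> onto \<open>V\<close> (\<open>cyclic_vector_bij\<close>). Fix \<open>v \<noteq> 0\<close> and subtract from
  \<open>t\<^sup>d\<close> the polynomial of degree below \<open>d\<close> that agrees with it on \<open>v\<close>; the result is a monic \<open>f\<close> of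
  degree \<open>d\<close> with \<open>f(T) v = 0\<close>. If \<open>f = ab\<close> with factors of degree below \<open>d\<close>, then \<open>b(T) v\<close> would be
  a nonzero vector killed by \<open>a(T)\<close>, so \<open>f\<close> is irreducible. Evaluation at \<open>v\<close> carries \<open>T\<^sub>f\<close> to \<open>T\<close>,
  which is the isotopism (\<open>irreducible_map_isotopic_Sf\<close>).

  Conversely let \<open>f\<close> be irreducible. In a nonzero \<open>T\<^sub>f\<close>-invariant subspace take a nonzero \<open>g\<close> of
  least degree; division with remainder shows that \<open>g\<close> divides \<open>f\<close> on the right, so \<open>g\<close> is constant
  and generates everything (\<open>mod_shift_irreducible_on\<close>). If \<open>deg f > 1\<close>, then \<open>T\<^sub>f\<close> is injective,
  since otherwise \<open>f\<close> would have the right factor \<open>b\<close> and left factor \<open>ct\<close> for some \<open>b\<close> and constant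
  \<open>c\<close> (\<open>mod_shift_inj_on\<close>), and finiteness makes it bijective. In degree one \<open>T\<^sub>f\<close> may vanish, for
  instance if \<open>f = t\<close>; but there the product does not involve \<open>T\<^sub>f\<close>, and the identity serves instead.

  All of this takes place on polynomials, whose type carries the additive structure; coordinate
  vectors are identified with polynomials of degree below \<open>d\<close> only at the end.
\<close>

section \<open>Polynomials acting through an additive map\<close>

definition poly_act :: "('k::field poly \<Rightarrow> 'k poly) \<Rightarrow> 'k poly \<Rightarrow> 'k poly \<Rightarrow> 'k poly" where
  "poly_act T a v = (\<Sum>i\<le>degree a. Polynomial.smult (coeff a i) ((T ^^ i) v))"

text \<open>
  Stating the bound on coefficients makes closure under the vector space operations immediate and
  covers \<open>d = 0\<close>, where only the zero polynomial remains.
\<close>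

definition polys_below :: "nat \<Rightarrow> 'a::zero poly set" where
  "polys_below d = {p. \<forall>i\<ge>d. coeff p i = 0}"

lemma in_polys_below_iff: "p \<in> polys_below d \<longleftrightarrow> p = 0 \<or> degree p < d"
  unfolding polys_below_def
  by (auto simp: coeff_eq_0) (metis leading_coeff_0_iff not_le)

lemma Sf_carrier_eq: "Sf_carrier f = polys_below (degree f)"
  by (auto simp: Sf_carrier_def in_polys_below_iff)

lemma polys_below_closed [simp, intro]:
  fixes p q :: "'k::field poly"
  shows "0 \<in> polys_below d"
    and "p \<in> polys_below d \<Longrightarrow> q \<in> polys_below d \<Longrightarrow> p + q \<in> polys_below d"
    and "p \<in> polys_below d \<Longrightarrow> q \<in> polys_below d \<Longrightarrow> p - q \<in> polys_below d"
    and "p \<in> polys_below d \<Longrightarrow> Polynomial.smult c p \<in> polys_below d"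
  by (auto simp: polys_below_def)

lemma finite_polys_below: "finite (polys_below d :: 'k::{field,finite} poly set)"
proof -
  have "polys_below d \<subseteq> Poly ` {xs :: 'k list. set xs \<subseteq> UNIV \<and> length xs = d}"
  proof
    fix p :: "'k poly" assume p: "p \<in> polys_below d"
    have "p = Poly (map (coeff p) [0..<d])"
      using p by (intro poly_eqI) (auto simp: polys_below_def coeff_Poly_eq nth_default_def)
    thus "p \<in> Poly ` {xs. set xs \<subseteq> UNIV \<and> length xs = d}" by auto
  qed
  thus ?thesis
    by (rule finite_subset) (intro finite_imageI finite_lists_length_eq finite_UNIV)
qed

lemma smult_sum_right: "Polynomial.smult c (sum f I) = (\<Sum>i\<in>I. Polynomial.smult c (f i))"
  by (induction I rule: infinite_finite_induct) (auto simp: smult_add_right)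

text \<open>
  Two actions can be compared term by term only after their sums run over a common range; this
  replaces the range \<open>{..degree a}\<close>, which varies with \<open>a\<close>.
\<close>

lemma poly_act_eq:
  assumes "a \<in> polys_below n"
  shows "poly_act T a v = (\<Sum>i<n. Polynomial.smult (coeff a i) ((T ^^ i) v))"
proof (cases "a = 0")
  case False
  hence "degree a < n" using assms by (auto simp: in_polys_below_iff)
  thus ?thesis unfolding poly_act_def
    by (intro sum.mono_neutral_left) (auto simp: coeff_eq_0)
qed (simp add: poly_act_def)

lemma poly_act_0 [simp]: "poly_act T 0 v = 0"
  by (simp add: poly_act_def)

lemma poly_act_add_left: "poly_act T (a + b) v = poly_act T a v + poly_act T b v"
proof -
  let ?n = "Suc (max (degree a) (degree b))"
  have "a \<in> polys_below ?n" "b \<in> polys_below ?n" "a + b \<in> polys_below ?n"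
    by (auto simp: polys_below_def coeff_eq_0)
  thus ?thesis by (simp add: poly_act_eq[of _ ?n] smult_add_left sum.distrib)
qed

lemma poly_act_smult_left: "poly_act T (Polynomial.smult c a) v = Polynomial.smult c (poly_act T a v)"
proof -
  let ?n = "Suc (degree a)"
  have "a \<in> polys_below ?n" "Polynomial.smult c a \<in> polys_below ?n"
    by (auto simp: polys_below_def coeff_eq_0)
  thus ?thesis by (simp add: poly_act_eq[of _ ?n] smult_sum_right del: sum.lessThan_Suc)
qed

lemma poly_act_minus_left: "poly_act T (- a) v = - poly_act T a v"
  using poly_act_smult_left[of T "-1" a v] by simp

lemma poly_act_diff_left: "poly_act T (a - b) v = poly_act T a v - poly_act T b v"
  using poly_act_add_left[of T a "-b" v] by (simp add: poly_act_minus_left)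

lemma poly_act_sum_left: "poly_act T (sum f I) v = (\<Sum>i\<in>I. poly_act T (f i) v)"
  by (induction I rule: infinite_finite_induct) (auto simp: poly_act_add_left)

lemma poly_act_monom: "poly_act T (monom c i) v = Polynomial.smult c ((T ^^ i) v)"
proof -
  have "monom c i \<in> polys_below (Suc i)" by (auto simp: polys_below_def)
  hence "poly_act T (monom c i) v =
      (\<Sum>j<Suc i. Polynomial.smult (if j = i then c else 0) ((T ^^ j) v))"
    by (simp add: poly_act_eq[of _ "Suc i"] eq_commute[of i])
  also have "\<dots> = Polynomial.smult c ((T ^^ i) v)" by simp
  finally show ?thesis .
qed

lemma poly_act_const: "poly_act T [:c:] v = Polynomial.smult c v"
  using poly_act_monom[of T c 0 v] by (simp add: monom_0)

lemma poly_act_closed: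
  assumes "0 \<in> W" "\<And>p q. p \<in> W \<Longrightarrow> q \<in> W \<Longrightarrow> p + q \<in> W"
    and "\<And>c p. p \<in> W \<Longrightarrow> Polynomial.smult c p \<in> W" and "\<And>p. p \<in> W \<Longrightarrow> T p \<in> W" and "v \<in> W"
  shows "poly_act T a v \<in> W"
proof -
  have "(T ^^ i) v \<in> W" for i by (induction i) (auto simp: assms)
  moreover have "sum f I \<in> W" if "\<And>i. f i \<in> W" for f and I :: "nat set"
    using that by (induction I rule: infinite_finite_induct) (auto simp: assms)
  ultimately show ?thesis unfolding poly_act_def using assms(3) by auto
qed

text \<open>
  A linear map commuting with the action of \<open>t\<close> is a module homomorphism. With \<open>M\<close> the reduction
  modulo \<open>f\<close> this yields the description of \<open>\<S>\<^sub>f\<close> as a module product.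
\<close>

lemma poly_act_intertwine:
  assumes add: "\<And>p q. M (p + q) = M p + M q"
    and smult: "\<And>c p. M (Polynomial.smult c p) = Polynomial.smult c (M p)"
    and comm: "\<And>p. M (T p) = T' (M p)"
  shows "M (poly_act T a v) = poly_act T' a (M v)"
proof -
  have M0: "M 0 = 0" using smult[of 0 0] by simp
  have "M ((T ^^ i) v) = (T' ^^ i) (M v)" for i by (induction i) (auto simp: comm)
  moreover have "M (sum f I) = (\<Sum>i\<in>I. M (f i))" for f and I :: "nat set"
    by (induction I rule: infinite_finite_induct) (auto simp: add M0)
  ultimately show ?thesis by (simp add: poly_act_def smult)
qed

text \<open>
  \<open>T\<close> is semilinear on all polynomials, although only its restriction to some \<open>polys_below d\<close> will
  matter: maps that are given on that subspace are extended by first truncating.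
\<close>

locale semilinear_poly_map = field_hom \<sigma>
  for \<sigma> :: "'k::field \<Rightarrow> 'k" +
  fixes T :: "'k poly \<Rightarrow> 'k poly"
  assumes map_add: "T (p + q) = T p + T q"
    and map_smult: "T (Polynomial.smult c p) = Polynomial.smult (\<sigma> c) (T p)"
begin

lemma pow_add: "(T ^^ n) (p + q) = (T ^^ n) p + (T ^^ n) q"
  by (induction n) (auto simp: map_add)

lemma pow_smult: "(T ^^ n) (Polynomial.smult c p) = Polynomial.smult ((\<sigma> ^^ n) c) ((T ^^ n) p)"
  by (induction n) (auto simp: map_smult)

lemma pow_zero: "(T ^^ n) 0 = 0"
  using pow_add[of n 0 0] by (metis add_0 add_cancel_left_right)

lemma pow_sum: "(T ^^ n) (sum f I) = (\<Sum>i\<in>I. (T ^^ n) (f i))"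
  by (induction I rule: infinite_finite_induct) (auto simp: pow_add pow_zero)

lemma poly_act_add_right: "poly_act T a (v + w) = poly_act T a v + poly_act T a w"
  by (simp add: poly_act_def pow_add smult_add_right sum.distrib)

lemma poly_act_zero_right [simp]: "poly_act T a 0 = 0"
  by (simp add: poly_act_def pow_zero)

text \<open>
  This is the module axiom, and it is where the commutation rule \<open>ta = \<sigma>(a)t\<close> meets semilinearity:
  moving \<open>T\<^sup>i\<close> past the scalar \<open>b\<^sub>j\<close> produces the same twist \<open>\<sigma>\<^sup>i(b\<^sub>j)\<close> as moving \<open>t\<^sup>i\<close> past it.
\<close>

lemma poly_act_skew_mult: "poly_act T (skew_mult \<sigma> a b) v = poly_act T a (poly_act T b v)"
proof -
  have "poly_act T (skew_mult \<sigma> a b) v =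
      (\<Sum>i\<le>degree a. \<Sum>j\<le>degree b.
        Polynomial.smult (coeff a i * (\<sigma> ^^ i) (coeff b j)) ((T ^^ (i + j)) v))"
    by (simp add: skew_mult_def poly_act_sum_left poly_act_monom)
  also have "\<dots> = (\<Sum>i\<le>degree a. Polynomial.smult (coeff a i) ((T ^^ i) (poly_act T b v)))"
    by (simp add: poly_act_def pow_sum pow_smult smult_sum_right funpow_add)
  also have "\<dots> = poly_act T a (poly_act T b v)" by (simp add: poly_act_def)
  finally show ?thesis .
qed

end

section \<open>Skew polynomial arithmetic\<close>

text \<open>
  Left multiplication by \<open>t\<close>, that is \<open>\<Sum> p\<^sub>j t\<^sup>j \<mapsto> \<Sum> \<sigma>(p\<^sub>j) t\<^bsup>j+1\<^esup>\<close>.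
\<close>

definition shift :: "('k::field \<Rightarrow> 'k) \<Rightarrow> 'k poly \<Rightarrow> 'k poly" where
  "shift \<sigma> p = pCons 0 (map_poly \<sigma> p)"

lemma semilinear_shift:
  assumes "field_hom \<sigma>"
  shows "semilinear_poly_map \<sigma> (shift \<sigma>)"
proof -
  interpret field_hom \<sigma> by fact
  show ?thesis
    by unfold_locales
      (auto simp: shift_def poly_eq_iff coeff_pCons coeff_map_poly hom_distribs split: nat.splits)
qed

text \<open>
  The map \<open>T\<^sub>f\<close>: the action of \<open>t\<close> on \<open>R/Rf\<close>, in terms of representatives of degree below \<open>deg f\<close>.
\<close>

definition mod_shift :: "('k::field \<Rightarrow> 'k) \<Rightarrow> 'k poly \<Rightarrow> 'k poly \<Rightarrow> 'k poly" where
  "mod_shift \<sigma> f p = skew_mod \<sigma> (shift \<sigma> p) f"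

locale skew_poly_ring = field_hom \<sigma> for \<sigma> :: "'k::field \<Rightarrow> 'k"
begin

lemma sigma_pow_zero [simp]: "(\<sigma> ^^ n) 0 = 0"
  by (induction n) auto

lemma sigma_pow_one [simp]: "(\<sigma> ^^ n) 1 = 1"
  by (induction n) auto

lemma sigma_pow_eq_0 [simp]: "(\<sigma> ^^ n) x = 0 \<longleftrightarrow> x = 0"
  by (induction n) auto

sublocale shift: semilinear_poly_map \<sigma> "shift \<sigma>"
  by (rule semilinear_shift[OF field_hom_axioms])

lemma coeff_shift_pow:
  "coeff ((shift \<sigma> ^^ i) p) k = (if k < i then 0 else (\<sigma> ^^ i) (coeff p (k - i)))"
proof (induction i arbitrary: k)
  case (Suc i)
  have "coeff ((shift \<sigma> ^^ Suc i) p) k = (case k of 0 \<Rightarrow> 0 | Suc k \<Rightarrow> \<sigma> (coeff ((shift \<sigma> ^^ i) p) k))"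
    by (simp add: shift_def coeff_pCons coeff_map_poly split: nat.split)
  thus ?case by (auto simp: Suc split: nat.splits)
qed simp

text \<open>
  The regular module: since skew multiplication is itself an action, associativity and distributivity
  are inherited from the general laws of \<open>poly_act\<close>.
\<close>

lemma skew_mult_eq: "skew_mult \<sigma> a b = poly_act (shift \<sigma>) a b"
proof -
  have "(shift \<sigma> ^^ i) b = (\<Sum>j\<le>degree b. monom ((\<sigma> ^^ i) (coeff b j)) (i + j))" for i
  proof (rule poly_eqI)
    fix k
    have "coeff (\<Sum>j\<le>degree b. monom ((\<sigma> ^^ i) (coeff b j)) (i + j)) k =
        (\<Sum>j\<le>degree b. if j = k - i \<and> i \<le> k then (\<sigma> ^^ i) (coeff b j) else 0)"
      by (auto simp: coeff_sum intro!: sum.cong)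
    also have "\<dots> = coeff ((shift \<sigma> ^^ i) b) k"
      by (cases "i \<le> k") (auto simp: coeff_shift_pow coeff_eq_0)
    finally show "coeff ((shift \<sigma> ^^ i) b) k =
        coeff (\<Sum>j\<le>degree b. monom ((\<sigma> ^^ i) (coeff b j)) (i + j)) k" ..
  qed
  thus ?thesis by (simp add: skew_mult_def poly_act_def smult_sum_right smult_monom)
qed

lemma skew_mult_assoc: "skew_mult \<sigma> (skew_mult \<sigma> a b) c = skew_mult \<sigma> a (skew_mult \<sigma> b c)"
  by (simp add: skew_mult_eq[of _ c] skew_mult_eq[of a "poly_act (shift \<sigma>) b c"] shift.poly_act_skew_mult)

lemmas skew_mult_simps =
  poly_act_add_left[of "shift \<sigma>", folded skew_mult_eq]
  poly_act_diff_left[of "shift \<sigma>", folded skew_mult_eq]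
  poly_act_smult_left[of "shift \<sigma>", folded skew_mult_eq]
  poly_act_const[of "shift \<sigma>", folded skew_mult_eq]
  shift.poly_act_add_right[folded skew_mult_eq]
  shift.poly_act_zero_right[folded skew_mult_eq]
  poly_act_0[of "shift \<sigma>", folded skew_mult_eq]

lemma skew_mult_t: "skew_mult \<sigma> (monom 1 1) b = shift \<sigma> b"
  by (simp add: skew_mult_eq poly_act_monom)

lemma skew_mult_one_left: "skew_mult \<sigma> 1 b = b"
  by (simp add: one_pCons skew_mult_simps)

lemma skew_mult_one_right: "skew_mult \<sigma> a 1 = a"
proof (rule poly_eqI)
  fix k
  have "coeff (skew_mult \<sigma> a 1) k = (\<Sum>i\<le>degree a. if i = k then coeff a i else 0)"
    unfolding skew_mult_eq poly_act_def coeff_sum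
    by (intro sum.cong) (auto simp: coeff_shift_pow)
  thus "coeff (skew_mult \<sigma> a 1) k = coeff a k" by (auto simp: coeff_eq_0)
qed

text \<open>
  The leading coefficient is nonzero whenever both factors are, because \<open>\<sigma>\<close> is injective; so degrees
  add and \<open>R\<close> has no zero divisors.
\<close>

lemma coeff_skew_mult_top:
  "coeff (skew_mult \<sigma> a b) (degree a + degree b) = lead_coeff a * (\<sigma> ^^ degree a) (lead_coeff b)"
proof -
  have "coeff (skew_mult \<sigma> a b) (degree a + degree b) =
     (\<Sum>i\<le>degree a. if i = degree a then lead_coeff a * (\<sigma> ^^ degree a) (lead_coeff b) else 0)"
    unfolding skew_mult_eq poly_act_def coeff_sum
    by (intro sum.cong) (auto simp: coeff_shift_pow coeff_eq_0)
  thus ?thesis by simp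
qed

lemma degree_skew_mult:
  assumes "a \<noteq> 0" "b \<noteq> 0"
  shows "degree (skew_mult \<sigma> a b) = degree a + degree b"
proof (rule antisym)
  show "degree (skew_mult \<sigma> a b) \<le> degree a + degree b"
    unfolding skew_mult_eq poly_act_def
    by (rule degree_le) (auto simp: coeff_sum coeff_shift_pow coeff_eq_0 intro!: sum.neutral)
  show "degree a + degree b \<le> degree (skew_mult \<sigma> a b)"
    by (rule le_degree) (use assms in \<open>simp add: coeff_skew_mult_top\<close>)
qed

lemma skew_mult_nonzero:
  assumes "a \<noteq> 0" "b \<noteq> 0"
  shows "skew_mult \<sigma> a b \<noteq> 0"
  using coeff_skew_mult_top[of a b] assms by auto

lemma right_division_exists:
  assumes "f \<noteq> 0"
  shows "\<exists>u v. a = skew_mult \<sigma> u f + v \<and> v \<in> polys_below (degree f)"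
proof (induction "degree a" arbitrary: a rule: less_induct)
  case less
  show ?case
  proof (cases "a \<in> polys_below (degree f)")
    case True
    thus ?thesis by (intro exI[of _ 0] exI[of _ a]) (auto simp: skew_mult_simps)
  next
    case False
    hence a: "a \<noteq> 0" and deg: "degree f \<le> degree a" by (auto simp: in_polys_below_iff)
    \<comment> \<open>\<open>c t\<^sup>k f\<close> has the leading term of \<open>a\<close>: passing \<open>t\<^sup>k\<close> turns the leading coefficient of \<open>f\<close>
      into its image under \<open>\<sigma>\<^sup>k\<close>, which \<open>c\<close> has to cancel.\<close>
    define k where "k = degree a - degree f"
    define c where "c = lead_coeff a / (\<sigma> ^^ k) (lead_coeff f)"
    have c: "c \<noteq> 0" using a assms by (simp add: c_def)
    define m where "m = skew_mult \<sigma> (monom c k) f"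
    have degm: "degree m = degree a"
      using c assms deg by (simp add: m_def degree_skew_mult degree_monom_eq monom_eq_0_iff k_def)
    have "coeff m (degree a) = lead_coeff a"
      using coeff_skew_mult_top[of "monom c k" f] c assms deg
      by (simp add: m_def degree_monom_eq k_def[symmetric] c_def) (simp add: k_def c_def)
    hence lc: "coeff (a - m) (degree a) = 0" by simp
    show ?thesis
    proof (cases "a - m = 0")
      case True
      thus ?thesis by (intro exI[of _ "monom c k"] exI[of _ 0]) (auto simp: m_def)
    next
      case False
      have "degree (a - m) \<le> degree a" using degree_diff_le_max[of a m] degm by simp
      moreover have "degree (a - m) \<noteq> degree a" using lc False by (metis leading_coeff_0_iff)
      ultimately obtain u v where "a - m = skew_mult \<sigma> u f + v" "v \<in> polys_below (degree f)"
        using less[of "a - m"] by fastforce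
      hence "a = skew_mult \<sigma> (u + monom c k) f + v"
        by (simp add: skew_mult_simps m_def algebra_simps)
      thus ?thesis using \<open>v \<in> _\<close> by blast
    qed
  qed
qed

lemma right_division_unique:
  assumes "skew_mult \<sigma> u f + v = skew_mult \<sigma> u' f + v'"
    and "v \<in> polys_below (degree f)" "v' \<in> polys_below (degree f)" "f \<noteq> 0"
  shows "v = v'"
proof (rule ccontr)
  assume "v \<noteq> v'"
  have eq: "skew_mult \<sigma> (u - u') f = v' - v"
    using assms(1) by (simp add: skew_mult_simps algebra_simps)
  have "u - u' \<noteq> 0" using eq \<open>v \<noteq> v'\<close> by (auto simp: skew_mult_simps)
  hence "degree f \<le> degree (v' - v)" using eq degree_skew_mult[of "u - u'" f] assms(4) by simp
  moreover have "v' - v \<in> polys_below (degree f)" using assms by auto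
  ultimately show False using \<open>v \<noteq> v'\<close> by (auto simp: in_polys_below_iff)
qed

context
  fixes f :: "'k poly"
  assumes f: "f \<noteq> 0"
begin

lemma skew_mod_eqI:
  assumes "a = skew_mult \<sigma> u f + v" "v \<in> polys_below (degree f)"
  shows "skew_mod \<sigma> a f = v"
  unfolding skew_mod_def in_polys_below_iff[symmetric]
  using assms right_division_unique[OF _ _ _ f] by (intro the_equality) auto

lemma skew_mod_decomp:
  obtains u where "a = skew_mult \<sigma> u f + skew_mod \<sigma> a f" "skew_mod \<sigma> a f \<in> polys_below (degree f)"
  using right_division_exists[OF f, of a] skew_mod_eqI by metis

lemma skew_mod_closed [simp]: "skew_mod \<sigma> a f \<in> polys_below (degree f)"
  using skew_mod_decomp by metis

lemma skew_mod_ident: "a \<in> polys_below (degree f) \<Longrightarrow> skew_mod \<sigma> a f = a"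
  by (rule skew_mod_eqI[of _ 0]) (auto simp: skew_mult_simps)

lemma skew_mod_add: "skew_mod \<sigma> (a + b) f = skew_mod \<sigma> a f + skew_mod \<sigma> b f"
proof -
  obtain u where u: "a = skew_mult \<sigma> u f + skew_mod \<sigma> a f" using skew_mod_decomp .
  obtain w where w: "b = skew_mult \<sigma> w f + skew_mod \<sigma> b f" using skew_mod_decomp .
  show ?thesis
    by (rule skew_mod_eqI[of _ "u + w"], subst u, subst w) (auto simp: skew_mult_simps algebra_simps)
qed

text \<open>
  The multiples \<open>uf\<close> form a left ideal, so the right factor of a product may be reduced first. The
  left factor may not, as \<open>Rf\<close> need not be two-sided.
\<close>

lemma skew_mod_skew_mult: "skew_mod \<sigma> (skew_mult \<sigma> a (skew_mod \<sigma> b f)) f = skew_mod \<sigma> (skew_mult \<sigma> a b) f"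
proof -
  obtain u where u: "b = skew_mult \<sigma> u f + skew_mod \<sigma> b f" using skew_mod_decomp .
  have eq: "skew_mult \<sigma> a b = skew_mult \<sigma> (skew_mult \<sigma> a u) f + skew_mult \<sigma> a (skew_mod \<sigma> b f)"
    by (subst u) (simp add: skew_mult_simps skew_mult_assoc)
  have zero: "skew_mod \<sigma> (skew_mult \<sigma> (skew_mult \<sigma> a u) f) f = 0"
    by (rule skew_mod_eqI) auto
  show ?thesis by (subst eq) (simp only: skew_mod_add zero add_0)
qed

lemma skew_mod_smult: "skew_mod \<sigma> (Polynomial.smult c a) f = Polynomial.smult c (skew_mod \<sigma> a f)"
proof -
  have "skew_mod \<sigma> (Polynomial.smult c (skew_mod \<sigma> a f)) f = Polynomial.smult c (skew_mod \<sigma> a f)"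
    by (intro skew_mod_ident polys_below_closed skew_mod_closed)
  thus ?thesis using skew_mod_skew_mult[of "[:c:]" a] by (simp only: skew_mult_simps)
qed

section \<open>The module of residues modulo f\<close>

lemma semilinear_mod_shift: "semilinear_poly_map \<sigma> (mod_shift \<sigma> f)"
  by unfold_locales (simp_all add: mod_shift_def shift.map_add shift.map_smult skew_mod_add skew_mod_smult)

lemma mod_shift_closed: "mod_shift \<sigma> f p \<in> polys_below (degree f)"
  by (simp add: mod_shift_def)

lemma skew_mod_shift: "skew_mod \<sigma> (shift \<sigma> p) f = mod_shift \<sigma> f (skew_mod \<sigma> p f)"
  using skew_mod_skew_mult[of "monom 1 1" p] unfolding mod_shift_def skew_mult_t by (rule sym)

lemma skew_mod_mult_eq_poly_act:
  "skew_mod \<sigma> (skew_mult \<sigma> a b) f = poly_act (mod_shift \<sigma> f) a (skew_mod \<sigma> b f)"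
  unfolding skew_mult_eq
  by (rule poly_act_intertwine) (simp_all add: skew_mod_add skew_mod_smult skew_mod_shift)

lemma Sf_mult_eq:
  "b \<in> polys_below (degree f) \<Longrightarrow> Sf_mult \<sigma> f a b = poly_act (mod_shift \<sigma> f) a b"
  by (simp add: Sf_mult_def skew_mod_mult_eq_poly_act skew_mod_ident)

text \<open>
  The class of \<open>1\<close> generates \<open>R/Rf\<close>.
\<close>

lemma poly_act_mod_shift_one:
  assumes "a \<in> polys_below (degree f)" "degree f > 0"
  shows "poly_act (mod_shift \<sigma> f) a 1 = a"
proof -
  have "1 \<in> polys_below (degree f)" using assms(2) by (simp add: in_polys_below_iff)
  hence "skew_mod \<sigma> 1 f = 1" by (rule skew_mod_ident)
  moreover have "skew_mod \<sigma> a f = a" using assms(1) by (rule skew_mod_ident)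
  ultimately show ?thesis
    using skew_mod_mult_eq_poly_act[of a 1] by (simp only: skew_mult_one_right)
qed

end

text \<open>
  If \<open>tb = uf\<close> with \<open>b \<noteq> 0\<close> of degree below \<open>deg f\<close>, comparing degrees forces \<open>u\<close> to be a constant,
  and then \<open>f = (u\<^bsup>-1\<^esup> t) b\<close> is a factorization into smaller degrees. The bound \<open>deg f > 1\<close> is what
  makes \<open>t\<close> a smaller factor; for \<open>f = t\<close> the map is zero.
\<close>

lemma mod_shift_inj_on:
  assumes irr: "skew_irreducible \<sigma> f" and deg: "degree f > 1"
  shows "inj_on (mod_shift \<sigma> f) (polys_below (degree f))"
proof -
  have f: "f \<noteq> 0" using deg by auto
  interpret S: semilinear_poly_map \<sigma> "mod_shift \<sigma> f" by (rule semilinear_mod_shift[OF f])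
  have ker: "b = 0" if b: "b \<in> polys_below (degree f)" and z: "mod_shift \<sigma> f b = 0" for b
  proof (rule ccontr)
    assume "b \<noteq> 0"
    obtain u where u: "shift \<sigma> b = skew_mult \<sigma> u f"
      using skew_mod_decomp[OF f, of "shift \<sigma> b"] z by (auto simp: mod_shift_def)
    have t: "(monom 1 1 :: 'k poly) \<noteq> 0" by (simp add: monom_eq_0_iff)
    have tb: "shift \<sigma> b \<noteq> 0" "degree (shift \<sigma> b) = Suc (degree b)"
      using skew_mult_nonzero[OF t \<open>b \<noteq> 0\<close>] degree_skew_mult[OF t \<open>b \<noteq> 0\<close>]
      unfolding skew_mult_t by (simp_all add: degree_monom_eq)
    have u0: "u \<noteq> 0" using u tb by (auto simp: skew_mult_simps)
    have bdeg: "degree b < degree f" using b \<open>b \<noteq> 0\<close> by (simp add: in_polys_below_iff)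
    have "degree u = 0" using degree_skew_mult[OF u0 f] u tb bdeg by simp
    then obtain c where c: "u = [:c:]" by (metis degree_eq_zeroE)
    have "c \<noteq> 0" using u0 c by simp
    hence "f = Polynomial.smult (inverse c) (shift \<sigma> b)" by (simp add: u c skew_mult_simps)
    also have "\<dots> = skew_mult \<sigma> (monom (inverse c) 1) b"
      by (simp add: skew_mult_eq poly_act_monom)
    finally have "f = skew_mult \<sigma> (monom (inverse c) 1) b" .
    moreover have "degree (monom (inverse c) 1) < degree f"
      using deg degree_monom_le[of "inverse c" 1] by linarith
    ultimately show False using irr bdeg unfolding skew_irreducible_def by blast
  qed
  show ?thesis
  proof (rule inj_onI)
    fix p q assume pq: "p \<in> polys_below (degree f)" "q \<in> polys_below (degree f)"
      and eq: "mod_shift \<sigma> f p = mod_shift \<sigma> f q"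
    have "mod_shift \<sigma> f (p - q) + mod_shift \<sigma> f q = mod_shift \<sigma> f p"
      using S.map_add[of "p - q" q] by simp
    hence "mod_shift \<sigma> f (p - q) = 0" using eq by simp
    thus "p = q" using ker[of "p - q"] pq by auto
  qed
qed

end

definition irreducible_on :: "nat \<Rightarrow> ('k::field poly \<Rightarrow> 'k poly) \<Rightarrow> bool" where
  "irreducible_on d T \<longleftrightarrow> (\<forall>W \<subseteq> polys_below d. 0 \<in> W \<and> (\<forall>p\<in>W. \<forall>q\<in>W. p + q \<in> W) \<and>
     (\<forall>c. \<forall>p\<in>W. Polynomial.smult c p \<in> W) \<and> T ` W \<subseteq> W \<longrightarrow> W = {0} \<or> W = polys_below d)"

lemma irreducible_onD:
  assumes "irreducible_on d T" "W \<subseteq> polys_below d" "0 \<in> W"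
    and "\<And>p q. p \<in> W \<Longrightarrow> q \<in> W \<Longrightarrow> p + q \<in> W"
    and "\<And>c p. p \<in> W \<Longrightarrow> Polynomial.smult c p \<in> W" and "\<And>p. p \<in> W \<Longrightarrow> T p \<in> W"
  shows "W = {0} \<or> W = polys_below d"
  by (rule assms(1)[unfolded irreducible_on_def, rule_format, OF assms(2)]) (use assms(3-6) in auto)

text \<open>
  The preimage in \<open>R\<close> of an invariant subspace \<open>W\<close> is a left ideal containing \<open>f\<close>. If \<open>W\<close> is nonzero,
  an element \<open>g\<close> of least degree among its nonzero members generates this ideal: the remainder of
  \<open>f\<close> by \<open>g\<close> again lies in \<open>W\<close>, hence vanishes, and irreducibility of \<open>f = ug\<close> leaves only
  \<open>deg g = 0\<close>.
\<close>

lemma (in skew_poly_ring) mod_shift_irreducible_on: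
  assumes irr: "skew_irreducible \<sigma> f"
  shows "irreducible_on (degree f) (mod_shift \<sigma> f)"
  unfolding irreducible_on_def
proof (intro allI impI, elim conjE)
  fix W assume sub: "W \<subseteq> polys_below (degree f)" and zero: "0 \<in> W"
    and add: "\<forall>p\<in>W. \<forall>q\<in>W. p + q \<in> W" and smult: "\<forall>c. \<forall>p\<in>W. Polynomial.smult c p \<in> W"
    and inv: "mod_shift \<sigma> f ` W \<subseteq> W"
  have deg: "degree f > 0" using irr by (simp add: skew_irreducible_def)
  hence f: "f \<noteq> 0" by auto
  have act: "poly_act (mod_shift \<sigma> f) a w \<in> W" if "w \<in> W" for a w
    by (rule poly_act_closed) (use that zero add smult inv in auto)
  show "W = {0} \<or> W = polys_below (degree f)"
  proof (cases "W = {0}")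
    case False
    then obtain g0 where "g0 \<in> W \<and> g0 \<noteq> 0" using zero by auto
    then obtain g where g: "g \<in> W" "g \<noteq> 0" and min: "\<And>h. h \<in> W \<Longrightarrow> h \<noteq> 0 \<Longrightarrow> degree g \<le> degree h"
      using arg_min_nat_lemma[of "\<lambda>h. h \<in> W \<and> h \<noteq> 0" g0 degree] by blast
    have gdeg: "degree g < degree f" using g sub by (auto simp: in_polys_below_iff)
    obtain u v where uv: "f = skew_mult \<sigma> u g + v" and v: "v \<in> polys_below (degree g)"
      using right_division_exists[OF g(2)] by blast
    have vV: "v \<in> polys_below (degree f)" using v gdeg by (auto simp: in_polys_below_iff)
    \<comment> \<open>Reducing \<open>f = ug + v\<close> modulo \<open>f\<close> expresses \<open>v\<close> through the action of \<open>u\<close> on \<open>g\<close>.\<close>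
    have "0 = skew_mod \<sigma> f f" using f
      by (intro skew_mod_eqI[OF f, symmetric, of _ 1]) (auto simp: skew_mult_one_left)
    also have "\<dots> = skew_mod \<sigma> (skew_mult \<sigma> u g) f + skew_mod \<sigma> v f"
      by (subst (1) uv) (rule skew_mod_add[OF f])
    also have "\<dots> = poly_act (mod_shift \<sigma> f) u g + v"
      using sub g vV by (auto simp: skew_mod_mult_eq_poly_act[OF f] skew_mod_ident[OF f])
    finally have "v = Polynomial.smult (-1) (poly_act (mod_shift \<sigma> f) u g)"
      by (simp add: eq_neg_iff_add_eq_0 add.commute)
    hence "v \<in> W" using act[OF g(1)] smult by blast
    hence "v = 0" using min[of v] v by (metis in_polys_below_iff not_le)
    hence fu: "f = skew_mult \<sigma> u g" using uv by simp
    hence u0: "u \<noteq> 0" using f by (auto simp: skew_mult_simps)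
    have "\<not> degree u < degree f" using irr fu gdeg unfolding skew_irreducible_def by blast
    hence "degree g = 0" using degree_skew_mult[OF u0 g(2)] fu by simp
    then obtain c where c: "g = [:c:]" by (metis degree_eq_zeroE)
    have "Polynomial.smult (inverse c) g \<in> W" using g smult by blast
    moreover have "Polynomial.smult (inverse c) g = 1" using c g(2) by (simp add: one_pCons)
    ultimately have "1 \<in> W" by simp
    have "polys_below (degree f) \<subseteq> W"
      using act[OF \<open>1 \<in> W\<close>] poly_act_mod_shift_one[OF f _ deg] by (metis subsetI)
    thus ?thesis using sub by auto
  qed auto
qed

lemma polys_below_1_const:
  assumes "p \<in> polys_below 1"
  obtains c where "p = [:c:]"
proof -
  have "degree p = 0" using assms by (auto simp: in_polys_below_iff)
  thus ?thesis using that by (rule degree_eq_zeroE)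
qed

lemma irreducible_on_1:
  fixes T :: "'k::field poly \<Rightarrow> 'k poly"
  shows "irreducible_on 1 T"
  unfolding irreducible_on_def
proof (intro allI impI, elim conjE)
  fix W :: "'k poly set"
  assume sub: "W \<subseteq> polys_below 1" and zero: "0 \<in> W"
    and smult: "\<forall>c. \<forall>p\<in>W. Polynomial.smult c p \<in> W"
  show "W = {0} \<or> W = polys_below 1"
  proof (cases "W = {0}")
    case False
    then obtain p where p: "p \<in> W" "p \<noteq> 0" using zero by auto
    obtain c where c: "p = [:c:]" using polys_below_1_const subsetD[OF sub p(1)] .
    have const: "[:b:] \<in> W" for b
    proof -
      have "Polynomial.smult (b / c) p \<in> W" using smult p(1) by simp
      thus ?thesis using c p(2) by simp
    qed
    have "q \<in> W" if "q \<in> polys_below 1" for q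
      using that by (rule polys_below_1_const) (simp add: const)
    thus ?thesis using sub by auto
  qed auto
qed

text \<open>
  For \<open>deg f > 1\<close> the witness is \<open>T\<^sub>f\<close>. For \<open>deg f = 1\<close> the map \<open>T\<^sub>f\<close> may fail to be injective; but
  then every first factor is a constant \<open>c\<close>, which acts as scalar multiplication by \<open>c\<close> through any
  map, and every map on a line is irreducible, so the identity can be used.
\<close>

lemma Sf_mult_as_irreducible_map:
  fixes f :: "'k::field poly"
  assumes iso: "field_isom \<sigma>" and irr: "skew_irreducible \<sigma> f"
  shows "\<exists>(\<tau> :: 'k \<Rightarrow> 'k) S. field_isom \<tau> \<and> semilinear_poly_map \<tau> S \<and>
    (\<forall>p\<in>polys_below (degree f). S p \<in> polys_below (degree f)) \<and>
    inj_on S (polys_below (degree f)) \<and> irreducible_on (degree f) S \<and>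
    (\<forall>a\<in>polys_below (degree f). \<forall>b\<in>polys_below (degree f). Sf_mult \<sigma> f a b = poly_act S a b)"
proof -
  interpret field_isom \<sigma> by fact
  interpret R: skew_poly_ring \<sigma> by unfold_locales
  have deg: "degree f > 0" using irr by (simp add: skew_irreducible_def)
  hence f0: "f \<noteq> 0" by auto
  show ?thesis
  proof (cases "degree f > 1")
    case True
    show ?thesis
      by (intro exI[of _ \<sigma>] exI[of _ "mod_shift \<sigma> f"] conjI ballI iso R.semilinear_mod_shift[OF f0]
          R.mod_shift_closed[OF f0] R.mod_shift_inj_on[OF irr True] R.mod_shift_irreducible_on[OF irr]
          R.Sf_mult_eq[OF f0])
  next
    case False
    hence d1: "degree f = 1" using deg by simp
    have "field_isom (id :: 'k \<Rightarrow> 'k)" by unfold_locales auto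
    moreover have "semilinear_poly_map id (id :: 'k poly \<Rightarrow> 'k poly)" by unfold_locales auto
    moreover have "Sf_mult \<sigma> f a b = poly_act id a b" if ab: "a \<in> polys_below 1" "b \<in> polys_below 1" for a b
    proof -
      obtain c where "a = [:c:]" using polys_below_1_const ab(1) .
      thus ?thesis using ab(2) by (simp add: R.Sf_mult_eq[OF f0] d1 poly_act_const)
    qed
    ultimately show ?thesis
      unfolding d1 using irreducible_on_1[of id]
      by (intro exI[of _ id] conjI ballI) simp_all
  qed
qed

section \<open>Irreducible maps and their cyclic vectors\<close>

text \<open>
  The vectors \<open>a(T) w\<close>, with \<open>a\<close> of any degree, form an invariant subspace and therefore exhaust the
  space. If a nonzero \<open>g\<close> of degree below \<open>d\<close> annihilated \<open>w\<close>, every \<open>a\<close> could be replaced by its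
  remainder modulo \<open>g\<close>, so the polynomials of degree below \<open>deg g\<close> would already suffice; but there
  are too few of them. Counting takes the place of dimension theory here.
\<close>

lemma cyclic_vector_bij:
  fixes T :: "'k::{field,finite} poly \<Rightarrow> 'k poly"
  assumes "semilinear_poly_map \<sigma> T" and irr: "irreducible_on d T"
    and closed: "\<And>p. p \<in> polys_below d \<Longrightarrow> T p \<in> polys_below d"
    and w: "w \<in> polys_below d" "w \<noteq> 0"
  shows "bij_betw (\<lambda>a. poly_act T a w) (polys_below d) (polys_below d)"
proof -
  interpret semilinear_poly_map \<sigma> T by fact
  interpret R: skew_poly_ring \<sigma> by unfold_locales
  let ?V = "polys_below d :: 'k poly set"
  let ?ev = "\<lambda>a. poly_act T a w"
  have into: "?ev a \<in> ?V" for a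
    by (rule poly_act_closed) (auto simp: closed w)
  have t_act: "?ev (skew_mult \<sigma> (monom 1 1) a) = T (?ev a)" for a
    by (simp add: poly_act_skew_mult poly_act_monom)
  have all: "range ?ev = ?V"
  proof -
    have "range ?ev = {0} \<or> range ?ev = ?V"
    proof (rule irreducible_onD[OF irr])
      show "range ?ev \<subseteq> ?V" using into by auto
      show "0 \<in> range ?ev" by (rule range_eqI[of _ _ 0]) simp
      show "p + q \<in> range ?ev" if "p \<in> range ?ev" "q \<in> range ?ev" for p q
        using that by (auto simp flip: poly_act_add_left)
      show "Polynomial.smult c p \<in> range ?ev" if "p \<in> range ?ev" for c p
        using that by (auto simp flip: poly_act_smult_left)
      show "T p \<in> range ?ev" if "p \<in> range ?ev" for p
        using that by (auto simp flip: t_act)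
    qed
    moreover have "w \<in> range ?ev"
      by (rule range_eqI[of _ _ "[:1:]"]) (simp add: poly_act_const)
    ultimately show ?thesis using w by auto
  qed
  have ker: "g = 0" if g: "g \<in> ?V" and z: "?ev g = 0" for g
  proof (rule ccontr)
    assume "g \<noteq> 0"
    let ?U = "polys_below (degree g) :: 'k poly set"
    have "?V \<subseteq> ?ev ` ?U"
    proof
      fix x assume "x \<in> ?V"
      then obtain a where a: "x = ?ev a" using all by blast
      obtain u v where uv: "a = skew_mult \<sigma> u g + v" "v \<in> ?U"
        using R.right_division_exists[OF \<open>g \<noteq> 0\<close>] by blast
      have "x = ?ev v" by (simp add: a uv(1) poly_act_add_left poly_act_skew_mult z)
      thus "x \<in> ?ev ` ?U" using uv by blast
    qed
    hence "card ?V \<le> card ?U" by (rule surj_card_le[OF finite_polys_below])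
    moreover have "?U \<subset> ?V"
      using g \<open>g \<noteq> 0\<close> by (auto simp: in_polys_below_iff)
    ultimately show False using psubset_card_mono[OF finite_polys_below] by (metis not_le)
  qed
  have "inj_on ?ev ?V"
  proof (rule inj_onI)
    fix p q assume "p \<in> ?V" "q \<in> ?V" "?ev p = ?ev q"
    thus "p = q" using ker[of "p - q"] by (auto simp: poly_act_diff_left)
  qed
  moreover have "?ev ` ?V = ?V"
    using into by (intro endo_inj_surj[OF finite_polys_below _ \<open>inj_on ?ev ?V\<close>]) blast
  ultimately show ?thesis by (simp add: bij_betw_def)
qed

section \<open>Isotopism\<close>

lemma additive_bij_inv:
  assumes "additive_bij F A B" and closed: "\<And>x y. x \<in> A \<Longrightarrow> y \<in> A \<Longrightarrow> x + y \<in> A"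
  shows "additive_bij (inv_into A F) B A"
proof -
  have bij: "bij_betw F A B" and add: "\<And>x y. x \<in> A \<Longrightarrow> y \<in> A \<Longrightarrow> F (x + y) = F x + F y"
    using assms(1) by (auto simp: additive_bij_def)
  have "inv_into A F (x + y) = inv_into A F x + inv_into A F y" if "x \<in> B" "y \<in> B" for x y
  proof -
    have mem: "inv_into A F x \<in> A" "inv_into A F y \<in> A"
      using that bij by (auto simp: bij_betw_def inv_into_into)
    have "F (inv_into A F x + inv_into A F y) = x + y"
      using that bij by (simp add: add[OF mem] bij_betw_inv_into_right)
    thus ?thesis using closed[OF mem] bij by (metis bij_betw_inv_into_left)
  qed
  thus ?thesis using bij_betw_inv_into[OF bij] by (simp add: additive_bij_def)
qed

lemma additive_bij_comp:
  assumes "additive_bij F A B" "additive_bij G B C"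
  shows "additive_bij (G \<circ> F) A C"
  using assms bij_betw_trans[of F A B G C] bij_betwE[of F A B]
  by (auto simp: additive_bij_def)

lemma isotopic_sym:
  assumes "isotopic A m B n" and add: "\<And>x y. x \<in> A \<Longrightarrow> y \<in> A \<Longrightarrow> x + y \<in> A"
    and mult: "\<And>x y. x \<in> A \<Longrightarrow> y \<in> A \<Longrightarrow> m x y \<in> A"
  shows "isotopic B n A m"
proof -
  obtain F G H where FGH: "additive_bij F A B" "additive_bij G A B" "additive_bij H A B"
    and eq: "\<And>x y. x \<in> A \<Longrightarrow> y \<in> A \<Longrightarrow> n (F x) (G y) = H (m x y)"
    using assms(1) unfolding isotopic_def by blast
  have "m (inv_into A F x) (inv_into A G y) = inv_into A H (n x y)" if "x \<in> B" "y \<in> B" for x y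
  proof -
    have mem: "inv_into A F x \<in> A" "inv_into A G y \<in> A"
      using that FGH by (auto simp: additive_bij_def bij_betw_def inv_into_into)
    have "H (m (inv_into A F x) (inv_into A G y)) = n x y"
      unfolding eq[OF mem, symmetric]
      using that FGH by (auto simp: additive_bij_def bij_betw_inv_into_right)
    thus ?thesis using mult[OF mem] FGH(3) by (metis additive_bij_def bij_betw_inv_into_left)
  qed
  thus ?thesis unfolding isotopic_def using FGH[THEN additive_bij_inv, OF add] by blast
qed

lemma isotopic_trans:
  assumes "isotopic A m B n" "isotopic B n C k"
  shows "isotopic A m C k"
proof -
  obtain F G H where 1: "additive_bij F A B" "additive_bij G A B" "additive_bij H A B"
    "\<And>x y. x \<in> A \<Longrightarrow> y \<in> A \<Longrightarrow> n (F x) (G y) = H (m x y)"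
    using assms(1) unfolding isotopic_def by blast
  obtain F' G' H' where 2: "additive_bij F' B C" "additive_bij G' B C" "additive_bij H' B C"
    "\<And>x y. x \<in> B \<Longrightarrow> y \<in> B \<Longrightarrow> k (F' x) (G' y) = H' (n x y)"
    using assms(2) unfolding isotopic_def by blast
  have "k ((F' \<circ> F) x) ((G' \<circ> G) y) = (H' \<circ> H) (m x y)" if "x \<in> A" "y \<in> A" for x y
  proof -
    have "F x \<in> B" "G y \<in> B" using 1 that by (auto simp: additive_bij_def dest: bij_betwE)
    thus ?thesis using 1 2 that by simp
  qed
  thus ?thesis unfolding isotopic_def
    using additive_bij_comp[OF 1(1) 2(1)] additive_bij_comp[OF 1(2) 2(2)] additive_bij_comp[OF 1(3) 2(3)]
    by blast
qed

lemma isotopicI_eq: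
  assumes "\<And>x y. x \<in> A \<Longrightarrow> y \<in> A \<Longrightarrow> n x y = m x y"
  shows "isotopic A m A n"
  unfolding isotopic_def additive_bij_def
  by (rule exI[of _ id], rule exI[of _ id], rule exI[of _ id]) (use assms in auto)

section \<open>From an irreducible map to a skew polynomial\<close>

text \<open>
  \<open>f\<close> is the monic annihilator of degree \<open>d\<close> of a nonzero vector, and evaluation at that vector is
  the second and third component of an isotopism from \<open>\<S>\<^sub>f\<close> whose first component is the identity.
\<close>

proposition irreducible_map_isotopic_Sf:
  fixes T :: "'k::{field,finite} poly \<Rightarrow> 'k poly"
  assumes semi: "semilinear_poly_map \<sigma> T" and irr: "irreducible_on d T" and d: "d \<ge> 1"
    and closed: "\<And>p. p \<in> polys_below d \<Longrightarrow> T p \<in> polys_below d"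
  shows "\<exists>f. skew_irreducible \<sigma> f \<and>
    isotopic (polys_below d) (poly_act T) (Sf_carrier f) (Sf_mult \<sigma> f)"
proof -
  interpret semilinear_poly_map \<sigma> T by fact
  interpret R: skew_poly_ring \<sigma> by unfold_locales
  let ?V = "polys_below d :: 'k poly set"
  have bij: "bij_betw (\<lambda>a. poly_act T a w) ?V ?V" if "w \<in> ?V" "w \<noteq> 0" for w
    using cyclic_vector_bij[OF semi irr] closed that by blast
  have act0: "a = 0" if "a \<in> ?V" "w \<in> ?V" "w \<noteq> 0" "poly_act T a w = 0" for a w
    using bij_betw_imp_inj_on[OF bij[OF that(2,3)]] that(1,4)
    by (auto dest: inj_onD[of _ _ a 0])
  have act_closed: "poly_act T a w \<in> ?V" if "w \<in> ?V" for a w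
    by (rule poly_act_closed) (use closed that in auto)
  \<comment> \<open>Any nonzero vector would do.\<close>
  define v0 :: "'k poly" where "v0 = 1"
  have v0: "v0 \<in> ?V" "v0 \<noteq> 0" using d by (auto simp: v0_def in_polys_below_iff)
  let ?ev = "\<lambda>a. poly_act T a v0"
  have ev: "bij_betw ?ev ?V ?V" by (rule bij[OF v0])
  obtain p where p: "p \<in> ?V" "?ev p = ?ev (monom 1 d)"
    using bij_betw_imp_surj_on[OF ev] act_closed[OF v0(1), of "monom 1 d"]
    by (metis (mono_tags, lifting) imageE)
  define f where "f = monom 1 d - p"
  have cf: "coeff f d = 1" "\<And>i. i > d \<Longrightarrow> coeff f i = 0"
    using p(1) by (auto simp: f_def polys_below_def)
  hence df: "degree f = d"
    by (intro antisym degree_le le_degree) auto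
  have f0: "f \<noteq> 0" using cf by auto
  have evf: "?ev f = 0" using p by (simp add: f_def poly_act_diff_left)
  have "skew_irreducible \<sigma> f"
    unfolding skew_irreducible_def df
  proof (intro conjI notI)
    show "d > 0" using d by simp
    assume "\<exists>a b. degree a < d \<and> degree b < d \<and> f = skew_mult \<sigma> a b"
    then obtain a b where ab: "a \<in> ?V" "b \<in> ?V" "f = skew_mult \<sigma> a b"
      by (auto simp: in_polys_below_iff)
    have "a \<noteq> 0" "b \<noteq> 0" using ab f0 by (auto simp: R.skew_mult_simps)
    have "poly_act T a (?ev b) = 0" using evf ab by (simp add: poly_act_skew_mult)
    moreover have "?ev b \<noteq> 0" using act0[OF ab(2) v0] \<open>b \<noteq> 0\<close> by blast
    ultimately show False using act0[OF ab(1) act_closed[OF v0(1)]] \<open>a \<noteq> 0\<close> by blast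
  qed
  moreover have "isotopic (Sf_carrier f) (Sf_mult \<sigma> f) ?V (poly_act T)"
  proof -
    \<comment> \<open>Evaluation at \<open>v0\<close> kills \<open>Rf\<close>, so it factors through reduction modulo \<open>f\<close>.\<close>
    have ev_mod: "?ev (skew_mod \<sigma> a f) = ?ev a" for a
    proof -
      obtain u where u: "a = skew_mult \<sigma> u f + skew_mod \<sigma> a f"
        using R.skew_mod_decomp[OF f0] .
      have "?ev a = ?ev (skew_mult \<sigma> u f) + ?ev (skew_mod \<sigma> a f)"
        by (subst u) (rule poly_act_add_left)
      thus ?thesis by (simp add: poly_act_skew_mult evf)
    qed
    have "additive_bij id ?V ?V" "additive_bij ?ev ?V ?V"
      using ev by (auto simp: additive_bij_def poly_act_add_left)
    moreover have "poly_act T (id a) (?ev b) = ?ev (Sf_mult \<sigma> f a b)" for a b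
      by (simp add: Sf_mult_def ev_mod poly_act_skew_mult)
    ultimately show ?thesis unfolding isotopic_def Sf_carrier_eq df by blast
  qed
  hence "isotopic ?V (poly_act T) (Sf_carrier f) (Sf_mult \<sigma> f)"
    by (rule isotopic_sym)
      (auto simp: Sf_carrier_eq Sf_mult_def R.skew_mod_closed[OF f0])
  ultimately show ?thesis by blast
qed


section \<open>Coordinate vectors as polynomials\<close>

definition poly_to_vec :: "nat \<Rightarrow> 'k::zero poly \<Rightarrow> 'k vec" where
  "poly_to_vec d p = vec d (coeff p)"

definition vec_to_poly :: "'k::zero vec \<Rightarrow> 'k poly" where
  "vec_to_poly v = Poly (list_of_vec v)"

lemma coeff_vec_to_poly: "coeff (vec_to_poly v) i = (if i < dim_vec v then v $ i else 0)"
  by (simp add: vec_to_poly_def coeff_Poly_eq nth_default_def list_of_vec_index)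

lemma poly_to_vec_closed [simp]: "poly_to_vec d p \<in> carrier_vec d"
  by (simp add: poly_to_vec_def)

lemma vec_to_poly_closed: "v \<in> carrier_vec d \<Longrightarrow> vec_to_poly v \<in> polys_below d"
  by (auto simp: polys_below_def coeff_vec_to_poly)

lemma poly_to_vec_inverse: "p \<in> polys_below d \<Longrightarrow> vec_to_poly (poly_to_vec d p) = p"
  by (rule poly_eqI) (auto simp: coeff_vec_to_poly poly_to_vec_def polys_below_def)

lemma vec_to_poly_inverse: "v \<in> carrier_vec d \<Longrightarrow> poly_to_vec d (vec_to_poly v) = v"
  by (rule eq_vecI) (auto simp: coeff_vec_to_poly poly_to_vec_def)

lemma vec_to_poly_add:
  "v \<in> carrier_vec d \<Longrightarrow> w \<in> carrier_vec d \<Longrightarrow>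
    vec_to_poly (v + w :: 'k::field vec) = vec_to_poly v + vec_to_poly w"
  by (rule poly_eqI) (auto simp: coeff_vec_to_poly)

lemma vec_to_poly_smult: "vec_to_poly (c \<cdot>\<^sub>v v :: 'k::field vec) = Polynomial.smult c (vec_to_poly v)"
  by (rule poly_eqI) (auto simp: coeff_vec_to_poly)

lemma poly_to_vec_add: "poly_to_vec d (p + q :: 'k::field poly) = poly_to_vec d p + poly_to_vec d q"
  by (rule eq_vecI) (auto simp: poly_to_vec_def)

lemma poly_to_vec_smult: "poly_to_vec d (Polynomial.smult c p :: 'k::field poly) = c \<cdot>\<^sub>v poly_to_vec d p"
  by (rule eq_vecI) (auto simp: poly_to_vec_def)

lemma vec_to_poly_zero [simp]: "vec_to_poly (0\<^sub>v d) = 0"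
  by (rule poly_eqI) (auto simp: coeff_vec_to_poly)

lemma poly_to_vec_zero [simp]: "poly_to_vec d 0 = 0\<^sub>v d"
  by (rule eq_vecI) (auto simp: poly_to_vec_def)

lemma bij_vec_to_poly: "bij_betw vec_to_poly (carrier_vec d) (polys_below d)"
  by (rule bij_betwI[of _ _ _ "poly_to_vec d"])
    (auto simp: vec_to_poly_closed vec_to_poly_inverse poly_to_vec_inverse)

lemma bij_poly_to_vec: "bij_betw (poly_to_vec d) (polys_below d) (carrier_vec d)"
  by (rule bij_betwI[of _ _ _ vec_to_poly])
    (auto simp: vec_to_poly_closed vec_to_poly_inverse poly_to_vec_inverse)

lemma additive_bij_vec_to_poly:
  "additive_bij vec_to_poly (carrier_vec d :: 'k::field vec set) (polys_below d)"
  by (auto simp: additive_bij_def bij_vec_to_poly vec_to_poly_add)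

lemma finite_carrier_vec: "finite (carrier_vec d :: 'k::{field,finite} vec set)"
  using finite_polys_below bij_betw_finite[OF bij_vec_to_poly] by blast

abbreviation vec_sum :: "nat \<Rightarrow> (nat \<Rightarrow> 'k::field) \<Rightarrow> (nat \<Rightarrow> 'k vec) \<Rightarrow> 'k vec" where
  "vec_sum d c e \<equiv> finsum_vec TYPE('k) d (\<lambda>i. c i \<cdot>\<^sub>v e i) {..<d}"

lemma
  fixes e :: "nat \<Rightarrow> 'k::field vec"
  assumes e: "\<And>i. i < d \<Longrightarrow> e i \<in> carrier_vec d"
  shows vec_sum_closed: "vec_sum d c e \<in> carrier_vec d"
    and vec_sum_index: "k < d \<Longrightarrow> vec_sum d c e $ k = (\<Sum>i<d. c i * e i $ k)"
proof -
  have f: "(\<lambda>i. c i \<cdot>\<^sub>v e i) \<in> {..<d} \<rightarrow> carrier_vec d" using e by auto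
  show "vec_sum d c e \<in> carrier_vec d" by (rule finsum_vec_closed[OF f])
  assume k: "k < d"
  have "vec_sum d c e $ k = (\<Sum>i<d. (c i \<cdot>\<^sub>v e i) $ k)"
    by (rule index_finsum_vec[OF _ k f]) simp
  also have "\<dots> = (\<Sum>i<d. c i * e i $ k)"
    using k e by (intro sum.cong refl) (metis carrier_vecD index_smult_vec(1) lessThan_iff)
  finally show "vec_sum d c e $ k = (\<Sum>i<d. c i * e i $ k)" .
qed

lemma indexed_basis_spans:
  fixes e :: "nat \<Rightarrow> 'k::field vec"
  assumes "indexed_basis d e"
  shows "i < d \<Longrightarrow> e i \<in> carrier_vec d"
    and "v \<in> carrier_vec d \<Longrightarrow> \<exists>c \<in> carrier_vec d. v = vec_sum d (\<lambda>i. c $ i) e"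
proof -
  interpret vec_space "TYPE('k)" d .
  have inj: "inj_on e {..<d}" and basis: "basis (e ` {..<d})"
    using assms by (auto simp: indexed_basis_def)
  have car: "e ` {..<d} \<subseteq> carrier_vec d" and span: "span (e ` {..<d}) = carrier_vec d"
    using basis by (auto simp: basis_def)
  show e: "e i \<in> carrier_vec d" if "i < d" for i using car that by auto
  assume "v \<in> carrier_vec d"
  then obtain a where a: "v = lincomb a (e ` {..<d})"
    using span finite_span[OF _ car] by auto
  have "v = finsum V (\<lambda>i. a (e i) \<cdot>\<^sub>v e i) {..<d}"
    unfolding a lincomb_def using car by (subst finsum_reindex[OF _ inj]) auto
  also have "\<dots> = vec_sum d (\<lambda>i. vec d (\<lambda>i. a (e i)) $ i) e"
    unfolding finsum_vec using e by (intro finsum_cong') auto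
  finally show "\<exists>c \<in> carrier_vec d. v = vec_sum d (\<lambda>i. c $ i) e" by (metis vec_carrier)
qed

text \<open>
  The map from coefficients to linear combinations is onto because the basis spans; as a surjection
  of a finite set onto itself it is bijective, and \<open>coordinates\<close> is its inverse.
\<close>

lemma additive_bij_coordinates:
  fixes e :: "nat \<Rightarrow> 'k::{field,finite} vec"
  assumes basis: "indexed_basis d e"
  shows "additive_bij (coordinates d e) (carrier_vec d) (carrier_vec d)"
proof -
  let ?C = "carrier_vec d :: 'k vec set"
  let ?L = "\<lambda>c. vec_sum d (\<lambda>i. c $ i) e"
  note e = indexed_basis_spans(1)[OF basis]
  have surj: "?L ` ?C = ?C"
    using indexed_basis_spans(2)[OF basis] vec_sum_closed[of d e, OF e] by blast
  hence "inj_on ?L ?C" by (intro eq_card_imp_inj_on finite_carrier_vec) simp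
  with surj have bij: "bij_betw ?L ?C ?C" by (simp add: bij_betw_def)
  have "?L (v + w) = ?L v + ?L w" if "v \<in> ?C" "w \<in> ?C" for v w
  proof (rule eq_vecI)
    have "dim_vec (?L c) = d" for c using vec_sum_closed[of d e, OF e] by (metis carrier_vecD)
    thus "dim_vec (?L (v + w)) = dim_vec (?L v + ?L w)" by simp
    fix k assume "k < dim_vec (?L v + ?L w)"
    hence k: "k < d" using vec_sum_closed[of d e, OF e] by (metis carrier_vecD index_add_vec(2))
    thus "?L (v + w) $ k = (?L v + ?L w) $ k"
      using that \<open>\<And>c. dim_vec (?L c) = d\<close>
      by (simp add: vec_sum_index[of d e, OF e] distrib_right sum.distrib)
  qed
  hence "additive_bij ?L ?C ?C" using bij by (simp add: additive_bij_def)
  hence inv: "additive_bij (inv_into ?C ?L) ?C ?C"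
    by (rule additive_bij_inv) (rule add_carrier_vec)
  have coord: "coordinates d e v = inv_into ?C ?L v" if "v \<in> ?C" for v
    unfolding coordinates_def
  proof (rule the_equality)
    have "v \<in> ?L ` ?C" using that unfolding surj .
    thus "inv_into ?C ?L v \<in> ?C \<and> v = ?L (inv_into ?C ?L v)"
      by (intro conjI inv_into_into f_inv_into_f[symmetric])
    show "c = inv_into ?C ?L v" if c: "c \<in> ?C \<and> v = ?L c" for c
      using bij_betw_inv_into_left[OF bij conjunct1[OF c]] unfolding conjunct2[OF c] by (rule sym)
  qed
  show ?thesis
    using inv coord bij_betw_cong[of ?C "coordinates d e" "inv_into ?C ?L" ?C]
    by (simp add: additive_bij_def)
qed

text \<open>
  \<open>S\<close> describes \<open>T\<close> in terms of polynomials. Fixing the relation between \<open>T\<close> and \<open>S\<close>, rather than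
  defining one from the other, lets both directions of the correspondence use the same facts.
\<close>

locale vec_poly_conjugate =
  fixes d :: nat and T :: "'k::field vec \<Rightarrow> 'k vec" and S :: "'k poly \<Rightarrow> 'k poly"
  assumes T_closed: "v \<in> carrier_vec d \<Longrightarrow> T v \<in> carrier_vec d"
    and conj: "v \<in> carrier_vec d \<Longrightarrow> vec_to_poly (T v) = S (vec_to_poly v)"
begin

lemma conj_poly: "p \<in> polys_below d \<Longrightarrow> T (poly_to_vec d p) = poly_to_vec d (S p)"
  by (metis T_closed conj poly_to_vec_closed poly_to_vec_inverse vec_to_poly_inverse)

lemma pow_closed: "v \<in> carrier_vec d \<Longrightarrow> (T ^^ i) v \<in> carrier_vec d"
  by (induction i) (auto simp: T_closed)

lemma pow_conj: "v \<in> carrier_vec d \<Longrightarrow> vec_to_poly ((T ^^ i) v) = (S ^^ i) (vec_to_poly v)"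
  by (induction i) (auto simp: conj pow_closed)

lemma ST_closed:
  "a \<in> carrier_vec d \<Longrightarrow> b \<in> carrier_vec d \<Longrightarrow> ST_mult d e T a b \<in> carrier_vec d"
  unfolding ST_mult_def by (rule vec_sum_closed) (rule pow_closed)

lemma ST_mult_conj:
  assumes "coordinates d e a \<in> carrier_vec d" "b \<in> carrier_vec d"
  shows "vec_to_poly (ST_mult d e T a b) =
    poly_act S (vec_to_poly (coordinates d e a)) (vec_to_poly b)"
proof (rule poly_eqI)
  fix k
  let ?c = "coordinates d e a"
  have dim: "dim_vec ?c = d" "\<And>i. dim_vec ((T ^^ i) b) = d"
    using assms pow_closed by (metis carrier_vecD)+
  have "coeff (vec_to_poly (ST_mult d e T a b)) k = (\<Sum>i<d. ?c $ i * coeff (vec_to_poly ((T ^^ i) b)) k)"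
    unfolding ST_mult_def coeff_vec_to_poly
    by (simp add: dim carrier_vecD[OF vec_sum_closed] pow_closed assms vec_sum_index)
  also have "\<dots> = coeff (poly_act S (vec_to_poly ?c) (vec_to_poly b)) k"
    by (simp add: poly_act_eq[OF vec_to_poly_closed[OF assms(1)]] coeff_sum pow_conj[OF assms(2)]
        coeff_vec_to_poly[of ?c] dim)
  finally show "coeff (vec_to_poly (ST_mult d e T a b)) k =
      coeff (poly_act S (vec_to_poly ?c) (vec_to_poly b)) k" .
qed

lemma irreducible_conj:
  "irreducible_transformation d T \<longleftrightarrow> irreducible_on d S"
proof
  assume irr: "irreducible_transformation d T"
  show "irreducible_on d S"
    unfolding irreducible_on_def
  proof (intro allI impI, elim conjE)
    fix W assume W: "W \<subseteq> polys_below d" "0 \<in> W" "\<forall>p\<in>W. \<forall>q\<in>W. p + q \<in> W"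
      "\<forall>c. \<forall>p\<in>W. Polynomial.smult c p \<in> W" "S ` W \<subseteq> W"
    let ?W = "poly_to_vec d ` W"
    have "VectorSpace.subspace class_ring ?W (module_vec TYPE('k) d)"
    proof (intro subspace.intro vec_vs submodule.intro vec_module)
      show "?W \<subseteq> carrier (module_vec TYPE('k) d)" by (auto simp: module_vec_simps)
      show "v \<oplus>\<^bsub>module_vec TYPE('k) d\<^esub> w \<in> ?W" if "v \<in> ?W" "w \<in> ?W" for v w
        using that W(3) by (auto simp: module_vec_simps simp flip: poly_to_vec_add)
      show "\<zero>\<^bsub>module_vec TYPE('k) d\<^esub> \<in> ?W"
        using W(2) by (auto simp: module_vec_simps intro!: image_eqI[of _ _ 0])
      show "c \<odot>\<^bsub>module_vec TYPE('k) d\<^esub> v \<in> ?W" if "v \<in> ?W" for c v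
        using that W(4) by (auto simp: module_vec_simps simp flip: poly_to_vec_smult)
    qed
    moreover have "T ` ?W \<subseteq> ?W"
      using W(1,5) by (auto simp: conj_poly subset_iff)
    ultimately have "?W = {0\<^sub>v d} \<or> ?W = carrier_vec d"
      using irr unfolding irreducible_transformation_def by blast
    moreover have "vec_to_poly ` ?W = W"
      using W(1) by (force simp: image_image poly_to_vec_inverse subset_iff)
    ultimately show "W = {0} \<or> W = polys_below d"
      by (metis bij_betw_imp_surj_on bij_vec_to_poly image_empty image_insert vec_to_poly_zero)
  qed
next
  assume irr: "irreducible_on d S"
  show "irreducible_transformation d T"
    unfolding irreducible_transformation_def
  proof (intro allI impI, elim conjE)
    fix W assume sub: "VectorSpace.subspace class_ring W (module_vec TYPE('k) d)" and inv: "T ` W \<subseteq> W"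
    interpret W: submodule class_ring W "module_vec TYPE('k) d"
      using sub by (simp add: subspace_def)
    have W: "W \<subseteq> carrier_vec d" using W.subset by (simp add: module_vec_simps)
    have "vec_to_poly ` W = {0} \<or> vec_to_poly ` W = polys_below d"
    proof (rule irreducible_onD[OF irr])
      show "vec_to_poly ` W \<subseteq> polys_below d" using W by (auto simp: vec_to_poly_closed)
      show "0 \<in> vec_to_poly ` W"
        using W.zero_closed by (auto simp: module_vec_simps intro!: image_eqI[of _ _ "0\<^sub>v d"])
      show "p + q \<in> vec_to_poly ` W" if pq: "p \<in> vec_to_poly ` W" "q \<in> vec_to_poly ` W" for p q
      proof -
        obtain v w where vw: "v \<in> W" "w \<in> W" "p = vec_to_poly v" "q = vec_to_poly w"
          using pq by (elim imageE)
        have "p + q = vec_to_poly (v + w)"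
          using vec_to_poly_add[of v d w] vw W by (simp add: subsetD)
        moreover have "v + w \<in> W" using W.m_closed[OF vw(1,2)] by (simp add: module_vec_simps)
        ultimately show ?thesis by blast
      qed
      show "Polynomial.smult c p \<in> vec_to_poly ` W" if "p \<in> vec_to_poly ` W" for c p
        using that W.smult_closed[of c] by (auto simp: module_vec_simps simp flip: vec_to_poly_smult)
      show "S p \<in> vec_to_poly ` W" if p: "p \<in> vec_to_poly ` W" for p
      proof -
        obtain v where v: "v \<in> W" "p = vec_to_poly v" using p by (elim imageE)
        have "S p = vec_to_poly (T v)" using conj[OF subsetD[OF W v(1)]] v(2) by simp
        moreover have "T v \<in> W" using inv v(1) by (simp add: image_subset_iff)
        ultimately show ?thesis by (rule image_eqI)
      qed
    qed
    moreover have "poly_to_vec d ` vec_to_poly ` W = W"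
      using W by (force simp: image_image vec_to_poly_inverse subset_iff)
    ultimately show "W = {0\<^sub>v d} \<or> W = carrier_vec d"
      by (metis bij_betw_imp_surj_on bij_poly_to_vec image_empty image_insert poly_to_vec_zero)
  qed
qed

end

text \<open>
  The first component of the isotopism involves the given basis, the other two the standard one. So
  the choice of basis does not affect the isotopy class.
\<close>

lemma ST_isotopic_poly_act:
  fixes T :: "'k::{field,finite} vec \<Rightarrow> 'k vec"
  assumes "vec_poly_conjugate d T S" "indexed_basis d e"
  shows "isotopic (carrier_vec d) (ST_mult d e T) (polys_below d) (poly_act S)"
proof -
  interpret vec_poly_conjugate d T S by fact
  note coord = additive_bij_coordinates[OF assms(2)]
  note F = additive_bij_comp[OF coord additive_bij_vec_to_poly]
  have "poly_act S ((vec_to_poly \<circ> coordinates d e) a) (vec_to_poly b) = vec_to_poly (ST_mult d e T a b)"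
    if "a \<in> carrier_vec d" "b \<in> carrier_vec d" for a b
  proof -
    have "coordinates d e a \<in> carrier_vec d"
      using coord that by (auto simp: additive_bij_def dest: bij_betwE)
    thus ?thesis using ST_mult_conj that by simp
  qed
  thus ?thesis unfolding isotopic_def using F additive_bij_vec_to_poly by blast
qed

text \<open>
  Since \<open>poly_to_vec d\<close> truncates linearly, the conjugate \<open>S\<close> is semilinear on polynomials of all
  degrees.
\<close>

lemma semilinear_imp_conjugate:
  assumes "field_hom \<sigma>" and T: "semilinear d \<sigma> T"
  defines "S \<equiv> \<lambda>p. vec_to_poly (T (poly_to_vec d p))"
  shows "semilinear_poly_map \<sigma> S" and "vec_poly_conjugate d T S"
    and "p \<in> polys_below d \<Longrightarrow> S p \<in> polys_below d"
proof -
  interpret field_hom \<sigma> by fact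
  have closed: "T v \<in> carrier_vec d" if "v \<in> carrier_vec d" for v
    using T that by (auto simp: semilinear_def)
  show "semilinear_poly_map \<sigma> S"
  proof
    show "S (p + q) = S p + S q" for p q
      using T closed
      by (simp add: S_def semilinear_def poly_to_vec_add vec_to_poly_add[of _ d])
    show "S (Polynomial.smult c p) = Polynomial.smult (\<sigma> c) (S p)" for c p
      using T by (simp add: S_def semilinear_def poly_to_vec_smult vec_to_poly_smult)
  qed
  show "vec_poly_conjugate d T S"
    by unfold_locales (simp_all add: closed S_def vec_to_poly_inverse)
  show "S p \<in> polys_below d" by (simp add: S_def vec_to_poly_closed closed)
qed

lemma conjugate_in_GammaL:
  fixes S :: "'k::{field,finite} poly \<Rightarrow> 'k poly"
  assumes iso: "field_isom \<sigma>" and "semilinear_poly_map \<sigma> S"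
    and closed: "\<And>p. p \<in> polys_below d \<Longrightarrow> S p \<in> polys_below d"
    and inj: "inj_on S (polys_below d)"
  defines "T \<equiv> \<lambda>v. poly_to_vec d (S (vec_to_poly v))"
  shows "T \<in> GammaL d" and "vec_poly_conjugate d T S"
proof -
  interpret semilinear_poly_map \<sigma> S by fact
  have "semilinear d \<sigma> T"
    by (auto simp: semilinear_def T_def vec_to_poly_add map_add map_smult vec_to_poly_smult
        poly_to_vec_add poly_to_vec_smult)
  moreover have "bij_betw T (carrier_vec d) (carrier_vec d)"
  proof -
    have "S ` polys_below d = polys_below d"
      using closed by (intro endo_inj_surj finite_polys_below inj) auto
    hence "bij_betw S (polys_below d) (polys_below d)" using inj by (simp add: bij_betw_def)
    hence "bij_betw (poly_to_vec d \<circ> (S \<circ> vec_to_poly)) (carrier_vec d) (carrier_vec d)"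
      using bij_vec_to_poly bij_poly_to_vec bij_betw_trans by metis
    thus ?thesis by (simp add: T_def comp_def)
  qed
  ultimately show "T \<in> GammaL d" using iso by (auto simp: GammaL_def)
  show "vec_poly_conjugate d T S"
    by unfold_locales (simp_all add: T_def poly_to_vec_inverse closed vec_to_poly_closed)
qed

theorem theorem1:
  shows "(\<forall>(d::nat) (e :: nat \<Rightarrow> 'k::{field,finite} vec) (T :: 'k vec \<Rightarrow> 'k vec).
            d \<ge> 1 \<and> indexed_basis d e \<and> T \<in> GammaL d \<and> irreducible_transformation d T \<longrightarrow>
            (\<exists>(\<sigma> :: 'k \<Rightarrow> 'k) f. field_isom \<sigma> \<and> skew_irreducible \<sigma> f \<and>
               isotopic (carrier_vec d) (ST_mult d e T) (Sf_carrier f) (Sf_mult \<sigma> f)))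
       \<and> (\<forall>(\<sigma> :: 'k \<Rightarrow> 'k) f (e :: nat \<Rightarrow> 'k vec).
            field_isom \<sigma> \<and> skew_irreducible \<sigma> f \<and> indexed_basis (degree f) e \<longrightarrow>
            (\<exists>T :: 'k vec \<Rightarrow> 'k vec. T \<in> GammaL (degree f) \<and> irreducible_transformation (degree f) T \<and>
               isotopic (Sf_carrier f) (Sf_mult \<sigma> f)
                 (carrier_vec (degree f)) (ST_mult (degree f) e T)))"
proof (intro conjI allI impI; elim conjE)
  fix d :: nat and e :: "nat \<Rightarrow> 'k vec" and T :: "'k vec \<Rightarrow> 'k vec"
  assume d: "d \<ge> 1" and basis: "indexed_basis d e" and T: "T \<in> GammaL d"
    and irr: "irreducible_transformation d T"
  obtain \<sigma> where iso: "field_isom \<sigma>" and semi: "semilinear d \<sigma> T"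
    using T by (auto simp: GammaL_def)
  interpret field_isom \<sigma> by fact
  note S = semilinear_imp_conjugate[OF field_hom_axioms semi]
  have "irreducible_on d (\<lambda>p. vec_to_poly (T (poly_to_vec d p)))"
    using vec_poly_conjugate.irreducible_conj[OF S(2)] irr by blast
  from irreducible_map_isotopic_Sf[OF S(1) this d S(3)] obtain f where
    f: "skew_irreducible \<sigma> f"
      "isotopic (polys_below d) (poly_act (\<lambda>p. vec_to_poly (T (poly_to_vec d p)))) (Sf_carrier f) (Sf_mult \<sigma> f)"
    by blast
  show "\<exists>(\<sigma> :: 'k \<Rightarrow> 'k) f. field_isom \<sigma> \<and> skew_irreducible \<sigma> f \<and>
      isotopic (carrier_vec d) (ST_mult d e T) (Sf_carrier f) (Sf_mult \<sigma> f)"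
    by (intro exI conjI, rule iso, rule f(1), rule isotopic_trans[OF ST_isotopic_poly_act[OF S(2) basis] f(2)])
next
  fix \<sigma> :: "'k \<Rightarrow> 'k" and f and e :: "nat \<Rightarrow> 'k vec"
  assume iso: "field_isom \<sigma>" and irr: "skew_irreducible \<sigma> f" and basis: "indexed_basis (degree f) e"
  interpret field_isom \<sigma> by fact
  interpret R: skew_poly_ring \<sigma> by unfold_locales
  let ?d = "degree f"
  have deg: "?d > 0" using irr by (simp add: skew_irreducible_def)
  hence f0: "f \<noteq> 0" by auto
  from Sf_mult_as_irreducible_map[OF iso irr]
  obtain \<tau> :: "'k \<Rightarrow> 'k" and S where S: "field_isom \<tau>" "semilinear_poly_map \<tau> S"
      "\<And>p. p \<in> polys_below ?d \<Longrightarrow> S p \<in> polys_below ?d" "inj_on S (polys_below ?d)" "irreducible_on ?d S"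
    and mult: "\<And>a b. a \<in> polys_below ?d \<Longrightarrow> b \<in> polys_below ?d \<Longrightarrow> Sf_mult \<sigma> f a b = poly_act S a b"
    by blast
  define T where "T = (\<lambda>v. poly_to_vec ?d (S (vec_to_poly v)))"
  have T: "T \<in> GammaL ?d" and conj: "vec_poly_conjugate ?d T S"
    using conjugate_in_GammaL[OF S(1-4)] unfolding T_def by auto
  have "isotopic (carrier_vec ?d) (ST_mult ?d e T) (Sf_carrier f) (Sf_mult \<sigma> f)"
    unfolding Sf_carrier_eq
    by (rule isotopic_trans[OF ST_isotopic_poly_act[OF conj basis] isotopicI_eq]) (rule mult)
  hence "isotopic (Sf_carrier f) (Sf_mult \<sigma> f) (carrier_vec ?d) (ST_mult ?d e T)"
    by (rule isotopic_sym) (auto intro: vec_poly_conjugate.ST_closed[OF conj])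
  moreover have "irreducible_transformation ?d T"
    using S(5) vec_poly_conjugate.irreducible_conj[OF conj] by blast
  ultimately show "\<exists>T :: 'k vec \<Rightarrow> 'k vec. T \<in> GammaL ?d \<and> irreducible_transformation ?d T \<and>
      isotopic (Sf_carrier f) (Sf_mult \<sigma> f) (carrier_vec ?d) (ST_mult ?d e T)"
    using T by (intro exI[of _ T] conjI)
qed

end
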